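(* Consider the following problem. The input is a finite undirected unweighted graph $G$ with an edge $e=\{u,v\}$ satisfying $\deg_G(u)=\deg_G(v)$; the algorithm knows the sets $L=\mathsf{Nbr}_G(u)\setminus(\mathsf{Nbr}_G(v)\cup\{v\})$ and $R=\mathsf{Nbr}_G(v)\setminus(\mathsf{Nbr}_G(u)\cup\{u\})$, with $|L|=|R|=n$, and accesses the edge weights of the complete bipartite graph $H=(L,R,w)$, $w(x,y)=\mathrm{dist}_G(x,y)\in\{1,2,3\}$, only via queries; it must output (an approximation of) the Ollivier–Ricci curvature $\mathfrak{C}_G(e)$. Consider any (randomized) local algorithm that is allowed to make an unlimited number of weighted selective degree queries, and let $Q$ be its expected number of queries, excluding all weighted selective degree queries, for computing $\mathfrak{C}_G(e)$ (on a worst-case input). Then: (a) If $\mathfrak{C}_G(e)$ is to be computed exactly, then (i) $Q>n^2/6$ if the queries used are weighted node-pair queries, and (ii) $Q>n/6$ if the queries used are weighted neighbor queries. (b) For every $0<\varepsilon<2$, any randomized algorithm computing an additive $(2-\varepsilon)$-approximation of $\mathfrak{C}_G(e)$ requires $Q>n/6$ weighted node-pair queries.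
   Context: $\mathsf{Nbr}_G(x)$ is the neighbor set, $\deg_G(x)=|\mathsf{Nbr}_G(x)|$, $\mathrm{dist}_G$ the shortest-path distance. The Ollivier–Ricci curvature of $e=\{u,v\}$ is $\mathfrak{C}_G(e)=1-\mathrm{EMD}$, where $\mathrm{EMD}$ is the optimal value of the linear program with variables $z_{x,y}\ge 0$ for $x\in\{u\}\cup\mathsf{Nbr}_G(u)$, $y\in\{v\}\cup\mathsf{Nbr}_G(v)$, minimizing $\sum_{x,y}\mathrm{dist}_G(x,y)z_{x,y}$ subject to $\sum_y z_{x,y}=1/(1+\deg_G(u))$ for every $x$ and $\sum_x z_{x,y}=1/(1+\deg_G(v))$ for every $y$ (earth mover's distance between the uniform distributions on the two closed neighborhoods). Queries on an edge-weighted complete bipartite graph $H=(L,R,w)$: a weighted node-pair query $(x,y)$ returns $w(x,y)$; a weighted neighbor query $(x,s)$ returns a uniformly random not-yet-explored node $z$ with $w(x,z)=s$, or a special symbol if none exists; a weighted selective degree query $(x,s)$ returns the number of edges of weight $s$ incident on $x$. An additive $\rho$-approximation of a quantity $X$ is a value $\beta$ with $X\le\beta\le X+\rho$.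
   Formalization: The bounds fail for small n (for n=1 free degree queries determine the curvature; in (b) a constant answer works if n ≤ 4/ε−2), so they are stated for n ≥ 7 in (a)(i), n ≥ 3 in (a)(ii), and n ≥ N(ε), N unspecified, in (b); algorithms are zero-error. *)

theory Defs
  imports "HOL-Probability.Probability"
begin

section \<open>Graphs and Ollivier--Ricci curvature\<close>

record 'a graph =
  verts :: "'a set"
  adj :: "('a \<times> 'a) set"

definition ugraph :: "'a graph \<Rightarrow> bool" where
  "ugraph G \<longleftrightarrow> finite (verts G) \<and> adj G \<subseteq> verts G \<times> verts G \<and> sym (adj G) \<and> irrefl (adj G)"

definition nbr :: "'a graph \<Rightarrow> 'a \<Rightarrow> 'a set" where
  "nbr G x = adj G `` {x}"

definition deg :: "'a graph \<Rightarrow> 'a \<Rightarrow> nat" where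
  "deg G x = card (nbr G x)"

text \<open>The relational power \<open>adj G ^^ k\<close> relates the endpoints of walks of length \<open>k\<close>.
  The value is unspecified for vertices in different components; below it is only applied to
  vertices of the two closed neighborhoods of the endpoints of an edge.\<close>

definition gdist :: "'a graph \<Rightarrow> 'a \<Rightarrow> 'a \<Rightarrow> nat" where
  "gdist G x y = (LEAST k. (x, y) \<in> adj G ^^ k)"

definition closed_nbr :: "'a graph \<Rightarrow> 'a \<Rightarrow> 'a set" where
  "closed_nbr G x = insert x (nbr G x)"

definition transport_plan :: "'a graph \<Rightarrow> 'a \<Rightarrow> 'a \<Rightarrow> ('a \<Rightarrow> 'a \<Rightarrow> real) \<Rightarrow> bool" where
  "transport_plan G u v z \<longleftrightarrow>
     (\<forall>x\<in>closed_nbr G u. \<forall>y\<in>closed_nbr G v. 0 \<le> z x y) \<and>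
     (\<forall>x\<in>closed_nbr G u. (\<Sum>y\<in>closed_nbr G v. z x y) = 1 / (1 + real (deg G u))) \<and>
     (\<forall>y\<in>closed_nbr G v. (\<Sum>x\<in>closed_nbr G u. z x y) = 1 / (1 + real (deg G v)))"

definition emd :: "'a graph \<Rightarrow> 'a \<Rightarrow> 'a \<Rightarrow> real" where
  "emd G u v = (INF z\<in>Collect (transport_plan G u v).
     \<Sum>x\<in>closed_nbr G u. \<Sum>y\<in>closed_nbr G v. real (gdist G x y) * z x y)"

definition ricci :: "'a graph \<Rightarrow> 'a \<Rightarrow> 'a \<Rightarrow> real" where
  "ricci G u v = 1 - emd G u v"

definition left_part :: "'a graph \<Rightarrow> 'a \<Rightarrow> 'a \<Rightarrow> 'a set" where
  "left_part G u v = nbr G u - insert v (nbr G v)"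

definition right_part :: "'a graph \<Rightarrow> 'a \<Rightarrow> 'a \<Rightarrow> 'a set" where
  "right_part G u v = nbr G v - insert u (nbr G u)"

type_synonym node = nat

definition instances :: "nat \<Rightarrow> (node graph \<times> node \<times> node) set" where
  "instances n = {(G, u, v). ugraph G \<and> (u, v) \<in> adj G \<and> deg G u = deg G v \<and>
     card (left_part G u v) = n \<and> card (right_part G u v) = n}"


section \<open>Queries\<close>

datatype query =
    NodePair node node
  | Neighbor node nat
  | is_SelDegree: SelDegree node nat

datatype answer =
    Number nat
  | Node "node option"

type_synonym history = "(query \<times> answer) list"

definition node_pair_queries :: "node set \<Rightarrow> node set \<Rightarrow> query set" where
  "node_pair_queries L R = {NodePair x y |x y. x \<in> L \<and> y \<in> R}"

definition neighbor_queries :: "node set \<Rightarrow> node set \<Rightarrow> query set" where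
  "neighbor_queries L R = {Neighbor x s |x s. x \<in> L \<union> R}"

definition sel_degree_queries :: "node set \<Rightarrow> node set \<Rightarrow> query set" where
  "sel_degree_queries L R = {SelDegree x s |x s. x \<in> L \<union> R}"

definition opposite :: "node set \<Rightarrow> node set \<Rightarrow> node \<Rightarrow> node set" where
  "opposite L R x = (if x \<in> L then R else L)"

text \<open>A node is explored from \<open>x\<close> once an earlier answer has revealed the weight of the edge
  joining it to \<open>x\<close>, from either endpoint.\<close>

definition explored :: "history \<Rightarrow> node \<Rightarrow> node set" where
  "explored h x = {z. \<exists>(q, a) \<in> set h.
     q = NodePair x z \<or> q = NodePair z x \<or>
     (\<exists>s. q = Neighbor x s \<and> a = Node (Some z)) \<or>
     (\<exists>s. q = Neighbor z s \<and> a = Node (Some x))}"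

text \<open>Only the weights \<open>w x y\<close> with \<open>x\<close> and \<open>y\<close> on opposite sides matter; \<open>w\<close> is symmetric.\<close>

fun reply :: "node set \<Rightarrow> node set \<Rightarrow> (node \<Rightarrow> node \<Rightarrow> nat) \<Rightarrow> history \<Rightarrow> query \<Rightarrow> answer pmf" where
  "reply L R w h (NodePair x y) = return_pmf (Number (w x y))"
| "reply L R w h (Neighbor x s) =
     (let Z = {z \<in> opposite L R x. w x z = s} - explored h x
      in if Z = {} then return_pmf (Node None) else map_pmf (\<lambda>z. Node (Some z)) (pmf_of_set Z))"
| "reply L R w h (SelDegree x s) = return_pmf (Number (card {z \<in> opposite L R x. w x z = s}))"


section \<open>Randomized adaptive algorithms\<close>

datatype action = Ask query | Output real

type_synonym strategy = "history \<Rightarrow> action pmf"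

text \<open>An execution yields the output and the complete query history. It may fail to terminate;
  the missing mass of the subprobability distribution is the probability of this.\<close>

partial_function (spmf) run ::
    "(history \<Rightarrow> query \<Rightarrow> answer pmf) \<Rightarrow> strategy \<Rightarrow> history \<Rightarrow> (real \<times> history) spmf" where
  "run rep \<sigma> h = bind_spmf (spmf_of_pmf (\<sigma> h)) (\<lambda>act.
     case act of
       Output \<beta> \<Rightarrow> return_spmf (\<beta>, h)
     | Ask q \<Rightarrow> bind_spmf (spmf_of_pmf (rep h q)) (\<lambda>a. run rep \<sigma> (h @ [(q, a)])))"

text \<open>The algorithm is told \<open>u\<close>, \<open>v\<close>, \<open>L\<close>, \<open>R\<close> and the common degree of \<open>u\<close> and \<open>v\<close>, without which
  the weights of \<open>H\<close> would not determine the curvature. Everything else is learnt from queries.\<close>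

type_synonym local_alg = "node \<Rightarrow> node \<Rightarrow> node set \<Rightarrow> node set \<Rightarrow> nat \<Rightarrow> strategy"

definition execute :: "local_alg \<Rightarrow> node graph \<Rightarrow> node \<Rightarrow> node \<Rightarrow> (real \<times> history) spmf" where
  "execute A G u v =
     (let L = left_part G u v; R = right_part G u v
      in run (reply L R (gdist G)) (A u v L R (deg G u)) [])"

definition uses_queries :: "(node set \<Rightarrow> node set \<Rightarrow> query set) \<Rightarrow> local_alg \<Rightarrow> bool" where
  "uses_queries K A \<longleftrightarrow> (\<forall>u v L R d h q. Ask q \<in> set_pmf (A u v L R d h) \<longrightarrow>
     q \<in> K L R \<union> sel_degree_queries L R)"

text \<open>Zero error: on every input the algorithm terminates almost surely and every possible output
  is acceptable.\<close>

definition solves :: "(real \<Rightarrow> real \<Rightarrow> bool) \<Rightarrow> nat \<Rightarrow> local_alg \<Rightarrow> bool" where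
  "solves acc n A \<longleftrightarrow> (\<forall>(G, u, v) \<in> instances n.
     lossless_spmf (execute A G u v) \<and>
     (\<forall>(\<beta>, h) \<in> set_spmf (execute A G u v). acc (ricci G u v) \<beta>))"

definition exact :: "real \<Rightarrow> real \<Rightarrow> bool" where
  "exact X \<beta> \<longleftrightarrow> \<beta> = X"

definition additive_approx :: "real \<Rightarrow> real \<Rightarrow> real \<Rightarrow> bool" where
  "additive_approx \<rho> X \<beta> \<longleftrightarrow> X \<le> \<beta> \<and> \<beta> \<le> X + \<rho>"

definition counted_queries :: "history \<Rightarrow> nat" where
  "counted_queries h = length (filter (\<lambda>(q, a). \<not> is_SelDegree q) h)"

definition expected_queries :: "local_alg \<Rightarrow> node graph \<Rightarrow> node \<Rightarrow> node \<Rightarrow> ennreal" where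
  "expected_queries A G u v =
     (\<integral>\<^sup>+ (\<beta>, h). of_nat (counted_queries h) \<partial>measure_spmf (execute A G u v))"

definition worst_case_queries :: "nat \<Rightarrow> local_alg \<Rightarrow> ennreal" where
  "worst_case_queries n A = (SUP (G, u, v) \<in> instances n. expected_queries A G u v)"

end

theory Submission
  imports Defs
begin

text \<open>
  Given \<open>S \<subseteq> L\<close> and \<open>T \<subseteq> R\<close>, let \<open>G\<close> be the graph whose only edges between \<open>L\<close> and \<open>R\<close> are those of
  \<open>(L - S) \<times> T \<union> S \<times> (R - T)\<close>; edges get weight 1 and all other pairs weight 3. The set \<open>S \<union> T\<close> is a
  vertex cover, so every matching is small and the earth mover's distance is large.
  A switch replaces edges \<open>(x, t), (s, y)\<close> by \<open>(x, y), (s, t)\<close>, where \<open>x \<in> L - S\<close>, \<open>y \<in> R - T\<close>,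
  \<open>s \<in> S\<close>, \<open>t \<in> T\<close>. It preserves all selective degrees and enlarges the maximum matching;
  after \<open>n - |S| - |T|\<close> switches there is a perfect matching. There are \<open>|S| |T|\<close> pairwise disjoint
  blocks in which to switch and every counted query reveals at most one pair. Hence as long as few
  queries were made on \<open>G\<close>, one can switch on unrevealed pairs only; the same transcript then also
  occurs with positive probability on the switched graph, whose curvature is too far away
  for one output to be correct on both. So every run on \<open>G\<close> is long, not merely the average one.
\<close>

section \<open>Switches\<close>

lemma card_exchange:
  assumes "finite S" "b \<in> S" "y \<notin> S"
  shows "card (insert y (S - {b})) = card S"
  using assms by (metis Diff_iff card_Suc_Diff1 card_insert_disjoint finite_Diff)

text \<open>Only the rows of \<open>x\<close> and \<open>a\<close> change, and each of them trades
  one neighbor for another.\<close>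

lemma card_switch:
  assumes fin: "finite {z. (p, z) \<in> E}" and E1: "E1 = E - {(x, b), (a, y)} \<union> {(x, y), (a, b)}"
    and "(x, b) \<in> E" "(a, y) \<in> E" "(x, y) \<notin> E" "(a, b) \<notin> E" "x \<noteq> a" "y \<noteq> b"
  shows "card {z. (p, z) \<in> E1} = card {z. (p, z) \<in> E}"
proof -
  consider "p = x" | "p = a" | "p \<noteq> x" "p \<noteq> a" by blast
  then show ?thesis
  proof cases
    case 1
    then have "{z. (p, z) \<in> E1} = insert y ({z. (p, z) \<in> E} - {b})"
      using assms by auto
    then show ?thesis
      using assms 1 card_exchange[of "{z. (p, z) \<in> E}"] by simp
  next
    case 2
    then have "{z. (p, z) \<in> E1} = insert b ({z. (p, z) \<in> E} - {y})"
      using assms by auto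
    then show ?thesis
      using assms 2 card_exchange[of "{z. (p, z) \<in> E}"] by simp
  next
    case 3
    then have "{z. (p, z) \<in> E1} = {z. (p, z) \<in> E}"
      using assms by auto
    then show ?thesis by simp
  qed
qed

text \<open>This is all that selective degree queries can detect: between \<open>L\<close> and
  \<open>R\<close> only the weights 1 and 3 will occur, so the number of edges at a node determines
  both of its weight counts.\<close>

definition same_degrees :: "('a \<times> 'a) set \<Rightarrow> ('a \<times> 'a) set \<Rightarrow> bool" where
  "same_degrees E E' \<longleftrightarrow> (\<forall>x. card {y. (x, y) \<in> E} = card {y. (x, y) \<in> E'} \<and>
     card {y. (y, x) \<in> E} = card {y. (y, x) \<in> E'})"

lemma same_degrees_trans: "same_degrees E F \<Longrightarrow> same_degrees F H \<Longrightarrow> same_degrees E H"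
  by (simp add: same_degrees_def)

lemma same_degrees_switch:
  assumes "finite E" "E1 = E - {(x, b), (a, y)} \<union> {(x, y), (a, b)}"
    and "(x, b) \<in> E" "(a, y) \<in> E" "(x, y) \<notin> E" "(a, b) \<notin> E" "x \<noteq> a" "y \<noteq> b"
  shows "same_degrees E E1"
  unfolding same_degrees_def
proof (intro allI conjI)
  fix p
  have "{z. (p, z) \<in> E} \<subseteq> snd ` E" "{z. (z, p) \<in> E} \<subseteq> fst ` E" by force+
  then have fin: "finite {z. (p, z) \<in> E}" "finite {z. (p, z) \<in> E\<inverse>}"
    using \<open>finite E\<close> by (auto intro: finite_subset)
  show "card {z. (p, z) \<in> E} = card {z. (p, z) \<in> E1}"
    using card_switch[OF fin(1) assms(2-8)] by simp
  \<comment> \<open>Transposition turns a switch into a switch, with \<open>x\<close> and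
    \<open>y\<close> exchanged and \<open>a\<close> and \<open>b\<close> exchanged.\<close>
  have "card {z. (p, z) \<in> E1\<inverse>} = card {z. (p, z) \<in> E\<inverse>}"
    by (rule card_switch[OF fin(2), of _ y a b x]) (use assms in auto)
  then show "card {z. (z, p) \<in> E} = card {z. (z, p) \<in> E1}"
    by simp
qed

text \<open>For injections \<open>g\<close> of \<open>A\<close> into \<open>X\<close> and \<open>h\<close> of \<open>B\<close> into \<open>Y\<close>, the blocks \<open>{g a, a} \<times> {h b, b}\<close>
  are pairwise disjoint, so every element of \<open>Q\<close> spoils at most one of them.\<close>

lemma exists_free_block:
  fixes A B X Y :: "'a set"
  assumes fin: "finite A" "finite B" "finite X" "finite Y" "finite Q" "finite F"
    and card: "card A \<le> card X" "card B \<le> card Y" "card Q + card F < card A * card B"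
    and disj: "A \<inter> X = {}" "B \<inter> Y = {}"
  obtains a b x y where "a \<in> A" "b \<in> B" "x \<in> X" "y \<in> Y" "(a, b) \<notin> F"
    "({x, a} \<times> {y, b}) \<inter> Q = {}"
proof -
  obtain g where g: "g ` A \<subseteq> X" "inj_on g A"
    using card_le_inj[OF fin(1,3) card(1)] by blast
  obtain h where h: "h ` B \<subseteq> Y" "inj_on h B"
    using card_le_inj[OF fin(2,4) card(2)] by blast
  \<comment> \<open>\<open>r\<close> sends every point of a block to the index \<open>(a, b)\<close>
    of that block, so the image of \<open>Q\<close> contains all spoiled indices. Values at points
    outside the blocks can only enlarge this image. \<open>F\<close> holds indices excluded in
    advance.\<close>
  define r where "r = (\<lambda>(p, q). (if p \<in> A then p else inv_into A g p,
    if q \<in> B then q else inv_into B h q))"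
  have r: "r c = (a, b)" if "a \<in> A" "b \<in> B" "c \<in> {g a, a} \<times> {h b, b}" for a b c
  proof -
    have "g a \<notin> A" "h b \<notin> B" using that g h disj by blast+
    then show ?thesis using that g h by (auto simp: r_def)
  qed
  have "card (r ` Q \<union> F) \<le> card Q + card F"
    by (meson add_mono card_Un_le card_image_le fin(5) le_trans order_refl)
  then have "card (r ` Q \<union> F) < card (A \<times> B)"
    using card(3) by (simp add: card_cartesian_product)
  then have "\<not> A \<times> B \<subseteq> r ` Q \<union> F"
    using fin by (meson card_mono finite_Un finite_imageI leD)
  then obtain a b where ab: "a \<in> A" "b \<in> B" "(a, b) \<notin> r ` Q" "(a, b) \<notin> F"
    by auto
  have "({g a, a} \<times> {h b, b}) \<inter> Q = {}"
  proof (intro equals0I)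
    fix c assume "c \<in> ({g a, a} \<times> {h b, b}) \<inter> Q"
    then have "(a, b) \<in> r ` Q"
      using r[OF ab(1,2), of c] by (metis IntD1 IntD2 imageI)
    then show False using ab(3) by contradiction
  qed
  then show thesis
    using that[of a b "g a" "h b"] ab g(1) h(1) by (simp add: image_subset_iff)
qed

text \<open>Induction on the deficiency \<open>r\<close>. A switch in a block free of
  \<open>Q\<close> creates the edges \<open>(x, y)\<close> and \<open>(a, b)\<close>. The first
  enters the matching, and \<open>x\<close>, \<open>y\<close> leave \<open>X\<close>,
  \<open>Y\<close>. The second uses up a place in \<open>A \<times> B\<close>, which is why the
  budget counts \<open>E \<inter> A \<times> B\<close>.\<close>

lemma exists_perfect_matching_switching:
  fixes A B X Y :: "'a set"
  assumes fin: "finite A" "finite B" "finite X" "finite Y" "finite Q" "finite E"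
    and disj: "A \<inter> X = {}" "B \<inter> Y = {}"
    and cX: "card X = card B + r" and cY: "card Y = card A + r"
    and near: "card A \<le> Suc (card B)" "card B \<le> Suc (card A)"
    and E: "X \<times> B \<subseteq> E" "A \<times> Y \<subseteq> E" "X \<times> Y \<inter> E = {}"
    and budget: "card Q + card (E \<inter> A \<times> B) + r \<le> card A * card B"
  shows "\<exists>E' f. same_degrees E E' \<and> (\<forall>p\<in>Q. p \<in> E' \<longleftrightarrow> p \<in> E) \<and>
    (\<forall>p. p \<notin> (A \<union> X) \<times> (B \<union> Y) \<longrightarrow> (p \<in> E' \<longleftrightarrow> p \<in> E)) \<and>
    bij_betw f (A \<union> X) (B \<union> Y) \<and> (\<forall>x\<in>A \<union> X. (x, f x) \<in> E')"
  using cX cY fin disj E budget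
proof (induction r arbitrary: X Y E)
  case 0
  \<comment> \<open>Without deficiency, \<open>X\<close> can be matched to \<open>B\<close> and
    \<open>A\<close> to \<open>Y\<close> inside the complete parts of \<open>E\<close>.\<close>
  obtain f where f: "bij_betw f X B"
    using 0 finite_same_card_bij by (metis add.right_neutral)
  obtain g where g: "bij_betw g A Y"
    using 0 finite_same_card_bij by (metis add.right_neutral)
  define m where "m = (\<lambda>x. if x \<in> A then g x else f x)"
  have "bij_betw m A Y"
    using g by (subst bij_betw_cong[of _ _ g]) (auto simp: m_def)
  moreover have "bij_betw m X B"
    using f 0 by (subst bij_betw_cong[of _ _ f]) (auto simp: m_def)
  ultimately have "bij_betw m (A \<union> X) (Y \<union> B)"
    by (rule bij_betw_combine) (use 0 in blast)
  moreover have "\<forall>x\<in>A \<union> X. (x, m x) \<in> E"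
  proof
    fix x assume x: "x \<in> A \<union> X"
    show "(x, m x) \<in> E"
    proof (cases "x \<in> A")
      case True
      then have "(x, m x) \<in> A \<times> Y" using bij_betwE[OF g] by (simp add: m_def)
      then show ?thesis using 0 by blast
    next
      case False
      then have "(x, m x) \<in> X \<times> B" using x bij_betwE[OF f] by (simp add: m_def)
      then show ?thesis using 0 by blast
    qed
  qed
  ultimately show ?case
    by (intro exI[of _ E] exI[of _ m]) (auto simp: same_degrees_def Un_commute)
next
  case (Suc r)
  have "card Q + card (E \<inter> A \<times> B) < card A * card B"
    using Suc.prems by simp
  moreover have "finite (E \<inter> A \<times> B)"
    using Suc.prems by simp
  \<comment> \<open>By \<open>near\<close> the two cardinalities differ by at most 1, and the
    surplus \<open>Suc r\<close> makes up for this.\<close>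
  moreover have "card A \<le> card X" "card B \<le> card Y"
    using Suc.prems near by auto
  ultimately obtain a b x y where abxy: "a \<in> A" "b \<in> B" "x \<in> X" "y \<in> Y" "(a, b) \<notin> E \<inter> A \<times> B"
    "({x, a} \<times> {y, b}) \<inter> Q = {}"
    using exists_free_block[OF Suc.prems(3-7) _ _ _ _ Suc.prems(9,10)] by metis
  define E1 where "E1 = E - {(x, b), (a, y)} \<union> {(x, y), (a, b)}"
  have xA: "x \<notin> A" and aX: "a \<notin> X" and yB: "y \<notin> B" and bY: "b \<notin> Y"
    using abxy Suc.prems(9,10) by blast+
  have ne: "x \<noteq> a" "y \<noteq> b" using xA yB abxy by auto
  have deg: "same_degrees E E1"
    by (rule same_degrees_switch[where x = x and y = y and a = a and b = b])
      (use abxy Suc.prems ne E1_def in auto)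
  have "E1 \<inter> A \<times> B = insert (a, b) (E \<inter> A \<times> B)"
    using abxy xA yB by (auto simp: E1_def)
  then have c: "card (E1 \<inter> A \<times> B) = Suc (card (E \<inter> A \<times> B))"
    using abxy Suc.prems by simp
  have e1: "(X - {x}) \<times> B \<subseteq> E1"
    using Suc.prems(11) yB aX by (auto simp: E1_def)
  have e2: "A \<times> (Y - {y}) \<subseteq> E1"
    using Suc.prems(12) yB aX xA bY by (auto simp: E1_def)
  have e3: "(X - {x}) \<times> (Y - {y}) \<inter> E1 = {}"
    using Suc.prems(13) aX by (auto simp: E1_def)
  have d: "A \<inter> (X - {x}) = {}" "B \<inter> (Y - {y}) = {}"
    using Suc.prems(9,10) by blast+
  have f: "finite (X - {x})" "finite (Y - {y})" "finite E1"
    using Suc.prems by (simp_all add: E1_def)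
  have k: "card (X - {x}) = card B + r" "card (Y - {y}) = card A + r"
    using Suc.prems(1,2) abxy by simp_all
  have q: "card Q + card (E1 \<inter> A \<times> B) + r \<le> card A * card B"
    using c Suc.prems(14) by simp
  obtain E' f where E': "same_degrees E1 E'" "\<forall>p\<in>Q. p \<in> E' \<longleftrightarrow> p \<in> E1"
    "\<forall>p. p \<notin> (A \<union> (X - {x})) \<times> (B \<union> (Y - {y})) \<longrightarrow> (p \<in> E' \<longleftrightarrow> p \<in> E1)"
    "bij_betw f (A \<union> (X - {x})) (B \<union> (Y - {y}))" "\<forall>x\<in>A \<union> (X - {x}). (x, f x) \<in> E'"
    using Suc.IH[OF k Suc.prems(3,4) f(1,2) Suc.prems(7) f(3) d e1 e2 e3 q] by blast
  have xy: "x \<notin> A \<union> (X - {x})" "y \<notin> B \<union> (Y - {y})"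
    "insert x (A \<union> (X - {x})) = A \<union> X" "insert y (B \<union> (Y - {y})) = B \<union> Y"
    using abxy xA yB by auto
  define m where "m = f(x := y)"
  have "bij_betw m (A \<union> (X - {x})) (B \<union> (Y - {y}))"
    using E'(4) xy(1) by (subst bij_betw_cong[of _ _ f]) (auto simp: m_def)
  then have "bij_betw m (A \<union> X) (B \<union> Y)"
    using notIn_Un_bij_betw[of x "A \<union> (X - {x})" m "B \<union> (Y - {y})"] xy
    by (simp add: m_def)
  \<comment> \<open>The pair \<open>(x, y)\<close> lies outside the smaller rectangle, so the
    remaining switches do not remove it.\<close>
  moreover have "(z, m z) \<in> E'" if "z \<in> A \<union> X" for z
    using that E'(3,5) xy(1,2) by (cases "z = x") (auto simp: m_def E1_def)
  moreover have "\<forall>p\<in>Q. p \<in> E' \<longleftrightarrow> p \<in> E"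
    using E'(2) abxy(6) by (auto simp: E1_def)
  moreover have "\<forall>p. p \<notin> (A \<union> X) \<times> (B \<union> Y) \<longrightarrow> (p \<in> E' \<longleftrightarrow> p \<in> E)"
    using E'(3) abxy by (auto simp: E1_def)
  ultimately show ?case
    using same_degrees_trans[OF deg E'(1)] by blast
qed


section \<open>Earth mover's distance and matchings\<close>

definition lipschitz_on_graph :: "'a graph \<Rightarrow> ('a \<Rightarrow> real) \<Rightarrow> bool" where
  "lipschitz_on_graph G f \<longleftrightarrow> (\<forall>(x, y)\<in>adj G. f x - f y \<le> 1)"

lemma lipschitz_walk:
  assumes "lipschitz_on_graph G f" "(x, y) \<in> adj G ^^ k"
  shows "f x - f y \<le> real k"
  using assms(2)
proof (induction k arbitrary: y)
  case (Suc k)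
  then obtain z where "(x, z) \<in> adj G ^^ k" "(z, y) \<in> adj G" by auto
  then have "f x - f z \<le> real k" "f z - f y \<le> 1"
    using Suc.IH assms(1) by (auto simp: lipschitz_on_graph_def)
  then show ?case by simp
qed simp

lemma gdist_le: "(x, y) \<in> adj G ^^ k \<Longrightarrow> gdist G x y \<le> k"
  unfolding gdist_def by (rule Least_le)

text \<open>Reachability ensures that the \<open>LEAST\<close> in \<open>gdist\<close> ranges over a
  nonempty set.\<close>

lemma gdist_walk: "(x, y) \<in> (adj G)\<^sup>* \<Longrightarrow> (x, y) \<in> adj G ^^ gdist G x y"
  unfolding gdist_def by (metis LeastI rtrancl_power)

lemma lipschitz_gdist:
  assumes "lipschitz_on_graph G f" "(x, y) \<in> (adj G)\<^sup>*"
  shows "f x - f y \<le> real (gdist G x y)"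
  using lipschitz_walk[OF assms(1) gdist_walk[OF assms(2)]] .

lemma gdist_self [simp]: "gdist G x x = 0"
  using gdist_le[of x x 0 G] by simp

lemma sym_relpow: "sym r \<Longrightarrow> sym (r ^^ k)"
proof (induction k)
  case (Suc k)
  show ?case
  proof (rule symI)
    fix x z assume "(x, z) \<in> r ^^ Suc k"
    then obtain y where "(x, y) \<in> r ^^ k" "(y, z) \<in> r" by auto
    then have "(y, x) \<in> r ^^ k" "(z, y) \<in> r"
      using Suc by (auto dest: symD)
    then show "(z, x) \<in> r ^^ Suc k" by (metis relpow_Suc_I2)
  qed
qed (auto simp: sym_def)

lemma gdist_commute:
  assumes "ugraph G"
  shows "gdist G x y = gdist G y x"
proof -
  have "(x, y) \<in> adj G ^^ k \<longleftrightarrow> (y, x) \<in> adj G ^^ k" for k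
    using assms sym_relpow by (metis ugraph_def symD)
  then show ?thesis by (simp add: gdist_def)
qed

abbreviation plan_cost :: "'a graph \<Rightarrow> 'a \<Rightarrow> 'a \<Rightarrow> ('a \<Rightarrow> 'a \<Rightarrow> real) \<Rightarrow> real" where
  "plan_cost G u v z \<equiv> \<Sum>x\<in>closed_nbr G u. \<Sum>y\<in>closed_nbr G v. real (gdist G x y) * z x y"

text \<open>With equal degrees all nodes carry the same mass, so sending each \<open>x\<close>
  entirely to \<open>p x\<close> is feasible. Nonemptiness is recorded because lower bounds on the
  infimum require it.\<close>

lemma emd_bij:
  assumes fin: "finite (closed_nbr G u)" and deg: "deg G u = deg G v"
    and p: "bij_betw p (closed_nbr G u) (closed_nbr G v)"
  shows "Collect (transport_plan G u v) \<noteq> {}"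
    and "emd G u v \<le> (\<Sum>x\<in>closed_nbr G u. real (gdist G x (p x))) / (1 + real (deg G u))"
proof -
  let ?X = "closed_nbr G u" and ?Y = "closed_nbr G v" and ?m = "1 / (1 + real (deg G u))"
  define z where "z = (\<lambda>x y. if y = p x then ?m else 0)"
  have finY: "finite ?Y" using fin p bij_betw_finite by blast
  have row: "(\<Sum>y\<in>?Y. c y * z x y) = c (p x) * ?m" if "x \<in> ?X" for x c
  proof -
    have "(\<Sum>y\<in>?Y. c y * z x y) = (\<Sum>y\<in>?Y. if y = p x then c y * ?m else 0)"
      by (rule sum.cong) (auto simp: z_def)
    also have "\<dots> = c (p x) * ?m"
      using finY that bij_betwE[OF p] by simp
    finally show ?thesis .
  qed
  have col: "(\<Sum>x\<in>?X. z x y) = ?m" if y: "y \<in> ?Y" for y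
  proof -
    obtain x where x: "x \<in> ?X" "y = p x" using p y by (auto simp: bij_betw_def)
    have "(\<Sum>x\<in>?X. z x y) = (\<Sum>x'\<in>?X. if x' = x then ?m else 0)"
      using x p by (intro sum.cong) (auto simp: z_def bij_betw_def inj_on_def)
    then show ?thesis using fin x by simp
  qed
  have z: "transport_plan G u v z"
    using row[of _ "\<lambda>_. 1"] col deg by (auto simp: transport_plan_def z_def)
  then show "Collect (transport_plan G u v) \<noteq> {}" by blast
  \<comment> \<open>A real infimum lies below its members only if the set is bounded below; here
    costs are nonnegative.\<close>
  have "bdd_below (plan_cost G u v ` Collect (transport_plan G u v))"
    by (intro bdd_belowI2[of _ 0] sum_nonneg) (auto simp: transport_plan_def)
  then have "emd G u v \<le> plan_cost G u v z"
    unfolding emd_def using z by (intro cINF_lower) auto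
  also have "\<dots> = (\<Sum>x\<in>?X. real (gdist G x (p x)) * ?m)"
    by (intro sum.cong row) auto
  finally show "emd G u v \<le> (\<Sum>x\<in>?X. real (gdist G x (p x))) / (1 + real (deg G u))"
    by (simp add: sum_divide_distrib)
qed

text \<open>Weak linear programming duality: the marginals give the total of
  \<open>(f x - f y) * z x y\<close> the same value for every plan, and termwise it is at most the
  cost.\<close>

lemma emd_ge_potential:
  assumes "Collect (transport_plan G u v) \<noteq> {}" and deg: "deg G u = deg G v"
    and f: "\<And>x y. x \<in> closed_nbr G u \<Longrightarrow> y \<in> closed_nbr G v \<Longrightarrow> f x - f y \<le> real (gdist G x y)"
  shows "(sum f (closed_nbr G u) - sum f (closed_nbr G v)) / (1 + real (deg G u)) \<le> emd G u v"
  unfolding emd_def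
proof (rule cINF_greatest[OF assms(1)])
  fix z assume "z \<in> Collect (transport_plan G u v)"
  then have z: "transport_plan G u v z" by simp
  let ?X = "closed_nbr G u" and ?Y = "closed_nbr G v" and ?m = "1 / (1 + real (deg G u))"
  have "(\<Sum>x\<in>?X. \<Sum>y\<in>?Y. f x * z x y) = (\<Sum>x\<in>?X. f x * ?m)"
    using z by (simp add: transport_plan_def flip: sum_distrib_left)
  moreover have "(\<Sum>x\<in>?X. \<Sum>y\<in>?Y. f y * z x y) = (\<Sum>y\<in>?Y. f y * ?m)"
    using z deg by (subst sum.swap) (simp add: transport_plan_def flip: sum_distrib_left)
  moreover have "(\<Sum>x\<in>?X. \<Sum>y\<in>?Y. (f x - f y) * z x y) \<le> plan_cost G u v z"
    using z f by (intro sum_mono mult_right_mono) (auto simp: transport_plan_def)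
  ultimately show "(sum f ?X - sum f ?Y) / (1 + real (deg G u)) \<le> plan_cost G u v z"
    by (simp add: left_diff_distrib sum_subtractf sum_divide_distrib diff_divide_distrib)
qed

section \<open>Graphs with a prescribed bipartite edge set, and their curvature\<close>

locale bipartite_instance =
  fixes u v :: node and L R :: "node set" and n :: nat
  assumes fin: "finite L" "finite R" and cards: "card L = n" "card R = n"
    and disj: "L \<inter> R = {}" "u \<noteq> v" "u \<notin> L" "u \<notin> R" "v \<notin> L" "v \<notin> R"
begin

text \<open>For \<open>E \<subseteq> L \<times> R\<close> this graph is bipartite with classes
  \<open>insert u R\<close> and \<open>insert v L\<close>. Distances from \<open>L\<close> to
  \<open>R\<close> are therefore odd, and at most 3 by way of \<open>u\<close> and
  \<open>v\<close>.\<close>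

definition graph_of :: "(node \<times> node) set \<Rightarrow> node graph" where
  "graph_of E = (let S = insert (u, v) ({u} \<times> L \<union> {v} \<times> R \<union> E)
     in \<lparr>verts = insert u (insert v (L \<union> R)), adj = S \<union> S\<inverse>\<rparr>)"

lemma adj_graph_of:
  "(x, y) \<in> adj (graph_of E) \<longleftrightarrow> (x, y) \<in> E \<or> (y, x) \<in> E \<or>
     x = u \<and> (y = v \<or> y \<in> L) \<or> x = v \<and> (y = u \<or> y \<in> R) \<or>
     y = u \<and> x \<in> L \<or> y = v \<and> x \<in> R"
  by (auto simp: graph_of_def Let_def)

text \<open>A 1-Lipschitz function is a feasible dual solution of the transport problem. This one is
  for a vertex cover \<open>C\<close> of the edges between \<open>L\<close> and \<open>R\<close>: uncovered pairs, which have distance 3,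
  attain the largest possible difference.\<close>

definition potential :: "node set \<Rightarrow> node \<Rightarrow> real" where
  "potential C z = (if z = u then 1 else if z = v then 0 else
     if z \<in> L then (if z \<in> C then 0 else 2) else (if z \<in> C then 1 else -1))"

context
  fixes E assumes E: "E \<subseteq> L \<times> R"
begin

lemma ugraph_graph_of: "ugraph (graph_of E)"
  unfolding ugraph_def
proof (intro conjI)
  show "adj (graph_of E) \<subseteq> verts (graph_of E) \<times> verts (graph_of E)"
    using E by (auto simp: graph_of_def Let_def)
  show "irrefl (adj (graph_of E))"
    using E disj unfolding irrefl_def adj_graph_of by auto
qed (use fin in \<open>auto simp: graph_of_def Let_def sym_def\<close>)

lemma nbr_graph_of: "nbr (graph_of E) u = insert v L" "nbr (graph_of E) v = insert u R"
proof -
  have E': "(x, y) \<notin> E \<or> x \<in> L \<and> y \<in> R" for x y using E by blast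
  have "x \<in> nbr (graph_of E) u \<longleftrightarrow> x \<in> insert v L" for x
    using E'[of u x] E'[of x u] disj unfolding nbr_def Image_singleton_iff adj_graph_of by blast
  moreover have "x \<in> nbr (graph_of E) v \<longleftrightarrow> x \<in> insert u R" for x
    using E'[of v x] E'[of x v] disj unfolding nbr_def Image_singleton_iff adj_graph_of by blast
  ultimately show "nbr (graph_of E) u = insert v L" "nbr (graph_of E) v = insert u R"
    by blast+
qed

lemma closed_nbr_graph_of:
  "closed_nbr (graph_of E) u = insert u (insert v L)"
  "closed_nbr (graph_of E) v = insert u (insert v R)"
  by (auto simp: closed_nbr_def nbr_graph_of)

lemma deg_graph_of: "deg (graph_of E) u = Suc n" "deg (graph_of E) v = Suc n"
  using fin cards disj by (auto simp: deg_def nbr_graph_of)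

lemma parts_graph_of: "left_part (graph_of E) u v = L" "right_part (graph_of E) u v = R"
  using disj by (auto simp: left_part_def right_part_def nbr_graph_of)

lemma reachable_graph_of:
  assumes "x \<in> closed_nbr (graph_of E) u" "y \<in> closed_nbr (graph_of E) v"
  shows "(x, y) \<in> (adj (graph_of E))\<^sup>*"
proof -
  have "(x, u) \<in> (adj (graph_of E))\<^sup>*"
    using assms(1) by (cases "x = u") (auto simp: closed_nbr_graph_of adj_graph_of)
  moreover have "(u, v) \<in> adj (graph_of E)"
    by (simp add: adj_graph_of)
  moreover have "(v, y) \<in> (adj (graph_of E))\<^sup>*"
    using assms(2) by (cases "y = v") (auto simp: closed_nbr_graph_of adj_graph_of)
  ultimately show ?thesis
    by (meson r_into_rtrancl rtrancl_trans)
qed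

text \<open>From an uncovered node of \<open>L\<close> to an uncovered node of \<open>R\<close> the
  potential drops by 3; each covered endpoint lowers this by 2, leaving 1 or -1. Edges at
  \<open>u\<close> or \<open>v\<close> always give 1 or -1.\<close>

lemma lipschitz_potential:
  assumes C: "\<And>x y. (x, y) \<in> E \<Longrightarrow> x \<in> C \<or> y \<in> C"
  shows "lipschitz_on_graph (graph_of E) (potential C)"
  unfolding lipschitz_on_graph_def
proof clarify
  fix x y assume xy: "(x, y) \<in> adj (graph_of E)"
  have nR: "z \<notin> L" if "z \<in> R" for z using disj(1) that by blast
  have *: "(x', y') \<in> E \<Longrightarrow> x' \<in> L \<and> y' \<in> R \<and> (x' \<in> C \<or> y' \<in> C)" for x' y'
    using E C by blast
  from xy consider "(x, y) \<in> E" | "(y, x) \<in> E" | "x = u" "y = v" | "x = u" "y \<in> L" | "x = v" "y = u"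
    | "x = v" "y \<in> R" | "y = u" "x \<in> L" | "y = v" "x \<in> R"
    unfolding adj_graph_of by blast
  then show "potential C x - potential C y \<le> 1"
  proof cases
    case 1
    with *[OF this] disj nR show ?thesis by (auto simp: potential_def)
  next
    case 2
    with *[OF this] disj nR show ?thesis by (auto simp: potential_def)
  qed (use disj nR in \<open>auto simp: potential_def\<close>)
qed

lemma gdist_graph_of:
  assumes "x \<in> L" "y \<in> R"
  shows "gdist (graph_of E) x y = (if (x, y) \<in> E then 1 else 3)"
proof (cases "(x, y) \<in> E")
  case True
  then have "(x, y) \<in> adj (graph_of E) ^^ 1" by (simp add: adj_graph_of)
  then have "gdist (graph_of E) x y \<le> 1" by (rule gdist_le)
  moreover have "gdist (graph_of E) x y \<noteq> 0"
  proof
    assume "gdist (graph_of E) x y = 0"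
    then have "x = y"
      using gdist_walk[OF reachable_graph_of[of x y]] assms by (auto simp: closed_nbr_graph_of)
    then show False using assms disj by blast
  qed
  ultimately show ?thesis using True by simp
next
  case False
  have "(x, u) \<in> adj (graph_of E)" "(u, v) \<in> adj (graph_of E)" "(v, y) \<in> adj (graph_of E)"
    using assms by (auto simp: adj_graph_of)
  then have "(x, y) \<in> adj (graph_of E) ^^ 3"
    unfolding numeral_3_eq_3 relpow.simps by blast
  then have "gdist (graph_of E) x y \<le> 3" by (rule gdist_le)
  \<comment> \<open>As \<open>(x, y)\<close> is not an edge, the nodes of
    \<open>L \<union> R\<close> other than \<open>x\<close> and \<open>y\<close> cover
    \<open>E\<close>; the potential is then 2 at \<open>x\<close> and -1 at
    \<open>y\<close>.\<close>
  moreover have "lipschitz_on_graph (graph_of E) (potential (L \<union> R - {x, y}))"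
    using E disj False assms by (intro lipschitz_potential) auto
  then have "potential (L \<union> R - {x, y}) x - potential (L \<union> R - {x, y}) y \<le> gdist (graph_of E) x y"
    by (rule lipschitz_gdist) (use reachable_graph_of assms closed_nbr_graph_of in auto)
  then have "3 \<le> gdist (graph_of E) x y"
    using assms disj by (auto simp: potential_def split: if_splits)
  ultimately show ?thesis using False by simp
qed

text \<open>\<open>u\<close> and \<open>v\<close> lie in both closed neighborhoods, so they can stay
  in place at no cost.\<close>

lemma bij_closed_nbr:
  assumes "bij_betw p L R"
  shows "bij_betw (\<lambda>x. if x \<in> L then p x else x)
    (closed_nbr (graph_of E) u) (closed_nbr (graph_of E) v)"
proof -
  have "bij_betw (\<lambda>x. if x \<in> L then p x else x) L R"
    using assms by (subst bij_betw_cong[of _ _ p]) auto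
  moreover have "bij_betw (\<lambda>x. if x \<in> L then p x else x) {u, v} {u, v}"
    using disj by (auto simp: bij_betw_def)
  ultimately have "bij_betw (\<lambda>x. if x \<in> L then p x else x) ({u, v} \<union> L) ({u, v} \<union> R)"
    using disj by (intro bij_betw_combine) auto
  then show ?thesis by (simp add: closed_nbr_graph_of insert_commute)
qed

lemma emd_graph_of_le:
  assumes p: "bij_betw p L R" "\<And>x. x \<in> L \<Longrightarrow> (x, p x) \<in> E"
  shows "emd (graph_of E) u v \<le> real n / (real n + 2)"
proof -
  have "emd (graph_of E) u v \<le> (\<Sum>x\<in>closed_nbr (graph_of E) u.
      real (gdist (graph_of E) x (if x \<in> L then p x else x))) / (1 + real (deg (graph_of E) u))"
    using emd_bij(2)[OF _ _ bij_closed_nbr[OF p(1)]] fin by (simp add: closed_nbr_graph_of deg_graph_of)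
  also have "(\<Sum>x\<in>closed_nbr (graph_of E) u.
      real (gdist (graph_of E) x (if x \<in> L then p x else x))) = (\<Sum>x\<in>L. real (gdist (graph_of E) x (p x)))"
    using disj fin by (simp add: closed_nbr_graph_of)
  also have "\<dots> = (\<Sum>x\<in>L. 1)"
    using p bij_betwE[OF p(1)] by (intro sum.cong) (auto simp: gdist_graph_of)
  finally show ?thesis by (simp add: cards deg_graph_of add.commute)
qed

text \<open>Duality with the potential of the cover: the dual sum starts from \<open>3 * n\<close>,
  and every node of the cover takes away 2.\<close>

lemma emd_graph_of_ge:
  assumes AB: "A \<subseteq> L" "B \<subseteq> R" and cover: "\<And>x y. (x, y) \<in> E \<Longrightarrow> x \<in> A \<or> y \<in> B"
  shows "(3 * real n - 2 * real (card A + card B)) / (real n + 2) \<le> emd (graph_of E) u v"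
proof -
  let ?f = "potential (A \<union> B)"
  \<comment> \<open>Any bijection serves here, since only feasibility is at stake.\<close>
  obtain p where p: "bij_betw p L R"
    using finite_same_card_bij[OF fin] cards by metis
  then have ne: "Collect (transport_plan (graph_of E) u v) \<noteq> {}"
    using emd_bij(1)[OF _ _ bij_closed_nbr[OF p]] fin by (simp add: closed_nbr_graph_of deg_graph_of)
  have lip: "lipschitz_on_graph (graph_of E) ?f"
    using cover by (intro lipschitz_potential) auto
  have "(\<Sum>x\<in>L. ?f x) = (\<Sum>x\<in>L. 2 - (if x \<in> A then 2 else 0))"
    using disj AB by (intro sum.cong) (auto simp: potential_def)
  also have "\<dots> = 2 * real n - 2 * real (card A)"
    using fin AB cards by (simp add: sum_subtractf sum.If_cases Int_absorb1)
  finally have sL: "(\<Sum>x\<in>L. ?f x) = 2 * real n - 2 * real (card A)" .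
  have "(\<Sum>y\<in>R. ?f y) = (\<Sum>y\<in>R. (if y \<in> B then 2 else 0) - 1)"
    using disj AB by (intro sum.cong) (auto simp: potential_def)
  also have "\<dots> = 2 * real (card B) - real n"
    using fin AB cards by (simp add: sum_subtractf sum.If_cases Int_absorb1)
  finally have sR: "(\<Sum>y\<in>R. ?f y) = 2 * real (card B) - real n" .
  have "sum ?f (closed_nbr (graph_of E) u) - sum ?f (closed_nbr (graph_of E) v) =
      (\<Sum>x\<in>L. ?f x) - (\<Sum>y\<in>R. ?f y)"
    using fin disj by (simp add: closed_nbr_graph_of)
  also have "\<dots> = 3 * real n - 2 * real (card A + card B)"
    by (simp add: sL sR)
  finally show ?thesis
    using emd_ge_potential[OF ne _ lipschitz_gdist[OF lip reachable_graph_of]]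
    by (simp add: deg_graph_of add.commute)
qed

end
end


section \<open>Transcripts of runs\<close>

text \<open>The possible transcripts of \<open>run\<close>, without their probabilities. Correctness
  of every possible output is a condition on the support alone, so only possibility has to be
  carried from one graph to another.\<close>

inductive trace :: "(history \<Rightarrow> query \<Rightarrow> answer pmf) \<Rightarrow> strategy \<Rightarrow> history \<Rightarrow> real \<Rightarrow> history \<Rightarrow> bool"
  for rep \<sigma> where
  stop: "Output b \<in> set_pmf (\<sigma> h) \<Longrightarrow> trace rep \<sigma> h b h"
| step: "Ask q \<in> set_pmf (\<sigma> h) \<Longrightarrow> a \<in> set_pmf (rep h q) \<Longrightarrow>
    trace rep \<sigma> (h @ [(q, a)]) b h' \<Longrightarrow> trace rep \<sigma> h b h'"

text \<open>Fixed point induction on \<open>run\<close>; the inclusion survives limits because the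
  support of the limit of a chain is the union of the supports.\<close>

lemma trace_if_set_spmf_run: "(b, h') \<in> set_spmf (run rep \<sigma> h) \<Longrightarrow> trace rep \<sigma> h b h'"
proof -
  have "set_spmf (run rep \<sigma> h) \<subseteq> {(b, h'). trace rep \<sigma> h b h'}"
  proof (induction arbitrary: h rule: run.fixp_induct)
    case 1
    show ?case by simp
  next
    case 2
    show ?case by simp
  next
    case (3 run')
    show ?case
    proof clarify
      fix b h'
      assume "(b, h') \<in> set_spmf (spmf_of_pmf (\<sigma> h) \<bind> (\<lambda>act. case act of
         Output \<beta> \<Rightarrow> return_spmf (\<beta>, h)
       | Ask q \<Rightarrow> spmf_of_pmf (rep h q) \<bind> (\<lambda>a. run' rep \<sigma> (h @ [(q, a)]))))"
      then obtain act where act: "act \<in> set_pmf (\<sigma> h)" "(b, h') \<in> set_spmf (case act of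
         Output \<beta> \<Rightarrow> return_spmf (\<beta>, h)
       | Ask q \<Rightarrow> spmf_of_pmf (rep h q) \<bind> (\<lambda>a. run' rep \<sigma> (h @ [(q, a)])))"
        by (auto simp: set_bind_spmf Set.bind_def simp del: bind_spmf_of_pmf)
      show "trace rep \<sigma> h b h'"
      proof (cases act)
        case (Output \<beta>)
        then show ?thesis using act by (auto intro: trace.stop)
      next
        case (Ask q)
        then obtain a where "a \<in> set_pmf (rep h q)" "(b, h') \<in> set_spmf (run' rep \<sigma> (h @ [(q, a)]))"
          using act(2) by (auto simp: set_bind_spmf Set.bind_def simp del: bind_spmf_of_pmf)
        then show ?thesis using act(1) 3 Ask by (blast intro: trace.step)
      qed
    qed
  qed
  then show "(b, h') \<in> set_spmf (run rep \<sigma> h) \<Longrightarrow> trace rep \<sigma> h b h'" by blast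
qed

lemma set_spmf_run_if_trace: "trace rep \<sigma> h b h' \<Longrightarrow> (b, h') \<in> set_spmf (run rep \<sigma> h)"
proof (induction rule: trace.induct)
  case (stop b h)
  show ?case
    unfolding run.simps[of rep \<sigma> h] set_bind_spmf set_spmf_spmf_of_pmf bind_UNION
    by (rule UN_I[OF stop]) simp
next
  case (step q h a b h')
  have "(b, h') \<in> set_spmf (spmf_of_pmf (rep h q) \<bind> (\<lambda>a. run rep \<sigma> (h @ [(q, a)])))"
    unfolding set_bind_spmf set_spmf_spmf_of_pmf bind_UNION
    by (rule UN_I[OF step(2)]) (simp add: step.IH)
  then show ?case
    unfolding run.simps[of rep \<sigma> h] set_bind_spmf[of "spmf_of_pmf (\<sigma> h)"] set_spmf_spmf_of_pmf
      bind_UNION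
    by (intro UN_I[OF step(1)]) simp
qed

lemma trace_prefix: "trace rep \<sigma> h b h' \<Longrightarrow> prefix h h'"
  by (induction rule: trace.induct) (auto dest: append_prefixD)

text \<open>Answers are compared only along prefixes of the final history \<open>h'\<close>, so the
  comparison may use everything that the whole transcript reveals.\<close>

lemma trace_transfer:
  assumes "trace rep \<sigma> h b h'"
    and "\<And>g q a. prefix (g @ [(q, a)]) h' \<Longrightarrow> Ask q \<in> set_pmf (\<sigma> g) \<Longrightarrow>
      a \<in> set_pmf (rep g q) \<Longrightarrow> a \<in> set_pmf (rep' g q)"
  shows "trace rep' \<sigma> h b h'"
  using assms
proof (induction rule: trace.induct)
  case (stop b h)
  then show ?case by (blast intro: trace.stop)
next
  case (step q h a b h')
  then show ?case by (blast intro: trace.step trace_prefix)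
qed

text \<open>Losslessness matters because the integral ignores the mass of runs that do not
  terminate.\<close>

lemma nn_integral_spmf_ge:
  assumes "lossless_spmf p" "\<And>x. x \<in> set_spmf p \<Longrightarrow> c \<le> f x"
  shows "c \<le> (\<integral>\<^sup>+ x. f x \<partial>measure_spmf p)"
proof -
  have "c = (\<integral>\<^sup>+ x. c \<partial>measure_spmf p)"
    using lossless_weight_spmfD[OF assms(1)]
    by (simp add: measure_spmf.emeasure_eq_measure space_measure_spmf weight_spmf_def)
  also have "\<dots> \<le> (\<integral>\<^sup>+ x. f x \<partial>measure_spmf p)"
    using assms(2) by (intro nn_integral_mono_AE) simp
  finally show ?thesis .
qed


section \<open>Switching on unrevealed pairs\<close>

lemma explored_mono: "set h \<subseteq> set H \<Longrightarrow> explored h x \<subseteq> explored H x"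
  unfolding explored_def by blast

lemma explored_commute: "z \<in> explored h x \<longleftrightarrow> x \<in> explored h z"
  unfolding explored_def by blast

lemma card_explored_le_counted_queries:
  assumes "L \<inter> R = {}"
  shows "card {(x, y) \<in> L \<times> R. y \<in> explored h x} \<le> counted_queries h"
proof -
  define orient where "orient = (\<lambda>(x::node, z). if x \<in> L then (x, z) else (z, x))"
  \<comment> \<open>The one pair that an entry reveals, with its node in \<open>L\<close> first,
    since queries may also start in \<open>R\<close>. The value \<open>(x, x)\<close> is a dummy for
    entries that reveal none.\<close>
  define pair where "pair = (\<lambda>(q, a). case q of
      NodePair x z \<Rightarrow> orient (x, z)
    | Neighbor x s \<Rightarrow> (case a of Node (Some z) \<Rightarrow> orient (x, z) | _ \<Rightarrow> (x, x))
    | SelDegree x s \<Rightarrow> (x, x))"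
  define F where "F = filter (\<lambda>(q, a). \<not> is_SelDegree q) h"
  have "{(x, y) \<in> L \<times> R. y \<in> explored h x} \<subseteq> pair ` set F"
  proof clarify
    fix x y assume xy: "x \<in> L" "y \<in> R" "y \<in> explored h x"
    then have or: "orient (x, y) = (x, y)" "orient (y, x) = (x, y)"
      using assms by (auto simp: orient_def)
    from xy(3) obtain q a where qa: "(q, a) \<in> set h" "q = NodePair x y \<or> q = NodePair y x \<or>
        (\<exists>s. q = Neighbor x s \<and> a = Node (Some y)) \<or> (\<exists>s. q = Neighbor y s \<and> a = Node (Some x))"
      unfolding explored_def by blast
    then have "(q, a) \<in> set F" "pair (q, a) = (x, y)"
      using or by (auto simp: F_def pair_def)
    then show "(x, y) \<in> pair ` set F" by (metis imageI)
  qed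
  then have "card {(x, y) \<in> L \<times> R. y \<in> explored h x} \<le> card (pair ` set F)"
    by (intro card_mono) auto
  also have "\<dots> \<le> length F"
    using card_image_le[of "set F" pair] card_length[of F] by simp
  finally show ?thesis by (simp add: counted_queries_def F_def)
qed

text \<open>\<open>H\<close> extends beyond \<open>q\<close>, so it also contains the pair revealed
  by \<open>q\<close> itself. A node drawn by a neighbor query thus keeps its weight under
  \<open>w'\<close> and, being unexplored in \<open>h\<close>, can be drawn there too.\<close>

lemma reply_transfer:
  assumes fin: "finite L" "finite R"
    and q: "q \<in> node_pair_queries L R \<union> neighbor_queries L R \<union> sel_degree_queries L R"
    and a: "a \<in> set_pmf (reply L R w h q)" and pre: "prefix (h @ [(q, a)]) H"
    and agree: "\<And>x z. x \<in> L \<union> R \<Longrightarrow> z \<in> opposite L R x \<Longrightarrow> z \<in> explored H x \<Longrightarrow> w' x z = w x z"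
    and degs: "\<And>x s. x \<in> L \<union> R \<Longrightarrow>
      card {z \<in> opposite L R x. w x z = s} = card {z \<in> opposite L R x. w' x z = s}"
  shows "a \<in> set_pmf (reply L R w' h q)"
proof -
  have H: "(q, a) \<in> set H" "set h \<subseteq> set H"
    using pre set_mono_prefix by fastforce+
  from q consider (pair) x y where "q = NodePair x y" "x \<in> L" "y \<in> R"
    | (nb) x s where "q = Neighbor x s" "x \<in> L \<union> R"
    | (sd) x s where "q = SelDegree x s" "x \<in> L \<union> R"
    unfolding node_pair_queries_def neighbor_queries_def sel_degree_queries_def by blast
  then show ?thesis
  proof cases
    case pair
    then have "y \<in> explored H x" "y \<in> opposite L R x"
      using H unfolding explored_def opposite_def by auto
    then show ?thesis using a pair agree[of x y] by simp
  next
    case sd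
    then show ?thesis using a degs[of x s] by simp
  next
    case nb
    define W where "W = (\<lambda>w. {z \<in> opposite L R x. w x z = s})"
    have finW: "finite (W w)" for w
      using fin by (simp add: W_def opposite_def)
    have reply: "reply L R w h q = (if W w - explored h x = {} then return_pmf (Node None)
        else map_pmf (\<lambda>z. Node (Some z)) (pmf_of_set (W w - explored h x)))" for w
      using nb by (simp add: W_def Let_def)
    show ?thesis
    proof (cases "W w - explored h x = {}")
      case True
      \<comment> \<open>The answer \<open>None\<close> means that all nodes of weight
        \<open>s\<close> are explored, so they have weight \<open>s\<close> under \<open>w'\<close>
        as well; equal cardinalities exclude any others.\<close>
      then have "W w \<subseteq> W w'"
        using agree[OF nb(2)] explored_mono[OF H(2), of x] by (auto simp: W_def)
      then have eq: "W w = W w'"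
        using card_subset_eq[OF finW] degs[OF nb(2), of s] by (simp add: W_def)
      show ?thesis using a True by (simp add: reply eq)
    next
      case False
      then obtain z where z: "a = Node (Some z)" "z \<in> W w" "z \<notin> explored h x"
        using a finW by (auto simp: reply)
      then have "z \<in> explored H x"
        using H(1) nb(1) unfolding explored_def by blast
      then have "z \<in> W w' - explored h x"
        using z agree[OF nb(2), of z] by (auto simp: W_def)
      then show ?thesis
        using z finW by (auto simp: reply)
    qed
  qed
qed

text \<open>Only two weights occur, so the size of one class fixes that of the other by
  complement.\<close>

lemma card_weight_class:
  assumes "finite S" "card {z \<in> S. P z} = card {z \<in> S. P' z}"
  shows "card {z \<in> S. (if P z then a else b :: nat) = s} = card {z \<in> S. (if P' z then a else b) = s}"
proof -
  have *: "card {z \<in> S. \<not> P z} = card S - card {z \<in> S. P z}" for P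
  proof -
    have "{z \<in> S. \<not> P z} = S - {z \<in> S. P z}" by auto
    then show ?thesis using assms(1) by (simp add: card_Diff_subset)
  qed
  have "{z \<in> S. (if P z then a else b) = s} = (if a = s then if b = s then S else {z \<in> S. P z}
      else if b = s then {z \<in> S. \<not> P z} else {})" for P
    by auto
  then show ?thesis using assms(2) * by simp
qed

context bipartite_instance
begin

lemma graph_of_in_instances: "E \<subseteq> L \<times> R \<Longrightarrow> (graph_of E, u, v) \<in> instances n"
  by (simp add: instances_def ugraph_graph_of deg_graph_of parts_graph_of cards adj_graph_of)

lemma opposite_bipartite: "x \<in> L \<Longrightarrow> opposite L R x = R" "x \<in> R \<Longrightarrow> opposite L R x = L"
  using disj by (auto simp: opposite_def)

lemma execute_transfer:
  assumes E: "E \<subseteq> L \<times> R" "E' \<subseteq> L \<times> R" and deg: "same_degrees E E'"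
    and A: "uses_queries K A" "\<And>L R. K L R \<subseteq> node_pair_queries L R \<union> neighbor_queries L R"
    and run: "(b, h) \<in> set_spmf (execute A (graph_of E) u v)"
    and agree: "\<And>x y. x \<in> L \<Longrightarrow> y \<in> R \<Longrightarrow> y \<in> explored h x \<Longrightarrow> (x, y) \<in> E' \<longleftrightarrow> (x, y) \<in> E"
  shows "(b, h) \<in> set_spmf (execute A (graph_of E') u v)"
proof -
  \<comment> \<open>On both graphs the algorithm is told the same nodes, parts and degree
    \<open>Suc n\<close>, so it follows the same strategy.\<close>
  let ?\<sigma> = "A u v L R (Suc n)"
  let ?w = "\<lambda>E. gdist (graph_of E)"
  have execute: "execute A (graph_of E) u v = run (reply L R (?w E)) ?\<sigma> []" if "E \<subseteq> L \<times> R" for E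
    using that by (simp add: execute_def parts_graph_of deg_graph_of)
  have w: "?w E x y = (if (x, y) \<in> E then 1 else 3)" "?w E y x = (if (x, y) \<in> E then 1 else 3)"
    if "E \<subseteq> L \<times> R" "x \<in> L" "y \<in> R" for E x y
    using that gdist_graph_of gdist_commute[OF ugraph_graph_of] by metis+
  have agree': "?w E' x z = ?w E x z"
    if "x \<in> L \<union> R" "z \<in> opposite L R x" "z \<in> explored h x" for x z
    using that agree w E opposite_bipartite explored_commute[of x h z] by (cases "x \<in> L") auto
  have degs: "card {z \<in> opposite L R x. ?w E x z = s} = card {z \<in> opposite L R x. ?w E' x z = s}"
    if "x \<in> L \<union> R" for x s
  proof (cases "x \<in> L")
    case True
    have "{z \<in> R. (x, z) \<in> E} = {z. (x, z) \<in> E}" if "E \<subseteq> L \<times> R" for E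
      using that by blast
    then have "card {z \<in> R. (x, z) \<in> E} = card {z \<in> R. (x, z) \<in> E'}"
      using deg E by (simp add: same_degrees_def)
    from card_weight_class[OF fin(2) this, of 1 3 s] True E show ?thesis
      by (simp add: opposite_bipartite w cong: conj_cong)
  next
    case False
    then have x: "x \<in> R" using that by blast
    have "{z \<in> L. (z, x) \<in> E} = {z. (z, x) \<in> E}" if "E \<subseteq> L \<times> R" for E
      using that by blast
    then have "card {z \<in> L. (z, x) \<in> E} = card {z \<in> L. (z, x) \<in> E'}"
      using deg E by (simp add: same_degrees_def)
    from card_weight_class[OF fin(1) this, of 1 3 s] x E show ?thesis
      by (simp add: opposite_bipartite w cong: conj_cong)
  qed
  have "trace (reply L R (?w E)) ?\<sigma> [] b h"
    using run by (simp add: execute E trace_if_set_spmf_run)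
  then have "trace (reply L R (?w E')) ?\<sigma> [] b h"
  proof (rule trace_transfer)
    fix g q a
    assume g: "prefix (g @ [(q, a)]) h" "Ask q \<in> set_pmf (?\<sigma> g)"
      "a \<in> set_pmf (reply L R (?w E) g q)"
    have "q \<in> node_pair_queries L R \<union> neighbor_queries L R \<union> sel_degree_queries L R"
      using A g(2) unfolding uses_queries_def by blast
    then show "a \<in> set_pmf (reply L R (?w E') g q)"
      using reply_transfer[OF fin _ g(3,1) agree' degs] by blast
  qed
  then show ?thesis
    by (simp add: execute E set_spmf_run_if_trace)
qed

text \<open>With fewer than \<open>c\<close> counted queries, the revealed pairs and the
  \<open>n - card S - card T\<close> switches fit into the \<open>card S * card T\<close> blocks.
  The output is then shared with the switched graph, against \<open>gap\<close>.\<close>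

lemma counted_queries_ge:
  assumes A: "uses_queries K A" "\<And>L R. K L R \<subseteq> node_pair_queries L R \<union> neighbor_queries L R"
    and solves: "solves acc n A"
    and S: "S \<subseteq> L" "T \<subseteq> R" "card S + card T \<le> n" "card S \<le> Suc (card T)" "card T \<le> Suc (card S)"
    and c: "c + (n - card S - card T) \<le> Suc (card S * card T)"
    and gap: "\<And>X X' b. X \<le> 1 - (3 * real n - 2 * real (card S + card T)) / (real n + 2) \<Longrightarrow>
      1 - real n / (real n + 2) \<le> X' \<Longrightarrow> acc X b \<Longrightarrow> \<not> acc X' b"
    and run: "(b, h) \<in> set_spmf (execute A (graph_of ((L - S) \<times> T \<union> S \<times> (R - T))) u v)"
  shows "c \<le> counted_queries h"
proof (rule ccontr)
  assume few: "\<not> c \<le> counted_queries h"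
  let ?E = "(L - S) \<times> T \<union> S \<times> (R - T)"
  define Q where "Q = {(x, y) \<in> L \<times> R. y \<in> explored h x}"
  have E: "?E \<subseteq> L \<times> R" using S by blast
  have finST: "finite S" "finite T" using S fin finite_subset by blast+
  have "card Q \<le> counted_queries h"
    unfolding Q_def by (rule card_explored_le_counted_queries[OF disj(1)])
  moreover have "?E \<inter> S \<times> T = {}" by blast
  \<comment> \<open>No edge joins \<open>S\<close> to \<open>T\<close> at first, and
    \<open>few\<close> bounds \<open>card Q\<close> strictly below \<open>c\<close>, which absorbs
    the \<open>Suc\<close> in assumption \<open>c\<close>.\<close>
  ultimately have budget: "card Q + card (?E \<inter> S \<times> T) + (n - card S - card T) \<le> card S * card T"
    using few c by simp
  have fins: "finite Q" "finite ?E" "finite (L - S)" "finite (R - T)"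
    using fin finST by (auto simp: Q_def intro: finite_subset[of _ "L \<times> R"])
  have cardX: "card (L - S) = card T + (n - card S - card T)"
    "card (R - T) = card S + (n - card S - card T)"
    using S finST cards by (simp_all add: card_Diff_subset)
  have disjX: "S \<inter> (L - S) = {}" "T \<inter> (R - T) = {}" "(L - S) \<times> (R - T) \<inter> ?E = {}"
    by blast+
  obtain E' f where E': "same_degrees ?E E'" "\<forall>p\<in>Q. p \<in> E' \<longleftrightarrow> p \<in> ?E"
    "\<forall>p. p \<notin> (S \<union> (L - S)) \<times> (T \<union> (R - T)) \<longrightarrow> (p \<in> E' \<longleftrightarrow> p \<in> ?E)"
    "bij_betw f (S \<union> (L - S)) (T \<union> (R - T))" "\<forall>x\<in>S \<union> (L - S). (x, f x) \<in> E'"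
    using exists_perfect_matching_switching[OF finST fins(3,4,1,2) disjX(1,2) cardX S(4,5)
        Un_upper1 Un_upper2 disjX(3) budget] by blast
  have LR: "S \<union> (L - S) = L" "T \<union> (R - T) = R" using S by blast+
  have E'_sub: "E' \<subseteq> L \<times> R"
    using E'(3) E unfolding LR by blast
  have "(b, h) \<in> set_spmf (execute A (graph_of E') u v)"
    by (rule execute_transfer[OF E E'_sub E'(1) A run]) (use E'(2) in \<open>auto simp: Q_def\<close>)
  then have "acc (ricci (graph_of ?E) u v) b" "acc (ricci (graph_of E') u v) b"
    using solves run graph_of_in_instances[OF E] graph_of_in_instances[OF E'_sub]
    unfolding solves_def by blast+
  moreover have "ricci (graph_of ?E) u v \<le>
      1 - (3 * real n - 2 * real (card S + card T)) / (real n + 2)"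
    using emd_graph_of_ge[OF E S(1,2)] by (auto simp: ricci_def)
  moreover have "1 - real n / (real n + 2) \<le> ricci (graph_of E') u v"
    using emd_graph_of_le[OF E'_sub, of f] E'(4,5) unfolding LR by (auto simp: ricci_def)
  ultimately show False using gap by blast
qed

end

section \<open>From long runs on one instance to worst-case bounds\<close>

lemma worst_case_queries_ge:
  assumes A: "uses_queries K A" "\<And>L R. K L R \<subseteq> node_pair_queries L R \<union> neighbor_queries L R"
    and solves: "solves acc n A"
    and k: "k + l \<le> n" "k \<le> Suc l" "l \<le> Suc k" "c + (n - k - l) \<le> Suc (k * l)"
    and gap: "\<And>X X' b. X \<le> 1 - (3 * real n - 2 * real (k + l)) / (real n + 2) \<Longrightarrow>
      1 - real n / (real n + 2) \<le> X' \<Longrightarrow> acc X b \<Longrightarrow> \<not> acc X' b"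
  shows "of_nat c \<le> worst_case_queries n A"
proof -
  define L R :: "node set" where "L = {2..<n + 2}" and "R = {n + 2..<2 * n + 2}"
  interpret bipartite_instance 0 1 L R n
    by unfold_locales (auto simp: L_def R_def)
  obtain S where S: "S \<subseteq> L" "card S = k"
    using obtain_subset_with_card_n[of k L] k(1) cards by auto
  obtain T where T: "T \<subseteq> R" "card T = l"
    using obtain_subset_with_card_n[of l R] k(1) cards by auto
  define G where "G = graph_of ((L - S) \<times> T \<union> S \<times> (R - T))"
  have inst: "(G, 0, 1) \<in> instances n"
    unfolding G_def by (rule graph_of_in_instances) (use S T in blast)
  have "c \<le> counted_queries h" if "(b, h) \<in> set_spmf (execute A G 0 1)" for b h
    using counted_queries_ge[OF A solves S(1) T(1)] k gap that unfolding G_def S(2) T(2) by blast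
  moreover have "lossless_spmf (execute A G 0 1)"
    using solves inst unfolding solves_def by blast
  ultimately have "of_nat c \<le> expected_queries A G 0 1"
    unfolding expected_queries_def by (intro nn_integral_spmf_ge) auto
  also have "\<dots> \<le> worst_case_queries n A"
    unfolding worst_case_queries_def using SUP_upper[OF inst, of "\<lambda>(G, u, v). expected_queries A G u v"]
    by simp
  finally show ?thesis .
qed

text \<open>In the two applications below, \<open>k + l = n - 1\<close>, so that a single switch suffices,
  and \<open>k = l = \<lfloor>\<epsilon> n / 16\<rfloor>\<close>, which is small against \<open>n\<close> although \<open>k\<^sup>2\<close> exceeds \<open>2 n\<close>.\<close>

lemma worst_case_queries_exact:
  assumes A: "uses_queries K A" "\<And>L R. K L R \<subseteq> node_pair_queries L R \<union> neighbor_queries L R"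
    and solves: "solves exact n A" and n: "1 \<le> n"
  shows "of_nat (n div 2 * ((n - 1) div 2)) \<le> worst_case_queries n A"
proof (rule worst_case_queries_ge[OF A solves, where k = "n div 2" and l = "(n - 1) div 2"])
  have sum: "n div 2 + (n - 1) div 2 = n - 1" using n by presburger
  then show "n div 2 * ((n - 1) div 2) + (n - n div 2 - (n - 1) div 2) \<le>
      Suc (n div 2 * ((n - 1) div 2))"
    using n by linarith
  fix X X' b
  assume X: "X \<le> 1 - (3 * real n - 2 * real (n div 2 + (n - 1) div 2)) / (real n + 2)"
    "1 - real n / (real n + 2) \<le> X'"
  \<comment> \<open>Hence the original curvature is at most 0, whereas that of the switched graph is
    positive.\<close>
  have "3 * real n - 2 * real (n div 2 + (n - 1) div 2) = real n + 2"
    unfolding sum using n by (simp add: of_nat_diff)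
  with X(1) have "X \<le> 1 - (real n + 2) / (real n + 2)" by (simp only:)
  then have "X \<le> 0" by simp
  moreover have "real n / (real n + 2) < 1" by simp
  then have "0 < X'" using X(2) by linarith
  ultimately show "exact X b \<Longrightarrow> \<not> exact X' b" by (auto simp: exact_def)
qed (use n in presburger)+

lemma worst_case_queries_additive_approx:
  assumes A: "uses_queries K A" "\<And>L R. K L R \<subseteq> node_pair_queries L R \<union> neighbor_queries L R"
    and \<epsilon>: "0 < \<epsilon>" "\<epsilon> < 2" and n: "2048 / \<epsilon>\<^sup>2 \<le> real n"
    and solves: "solves (additive_approx (2 - \<epsilon>)) n A"
  shows "of_nat (Suc (n div 6)) \<le> worst_case_queries n A"
proof -
  define k where "k = nat \<lfloor>\<epsilon> * real n / 16\<rfloor>"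
  \<comment> \<open>Here 2048 is 2 times the square of 32: the bound
    \<open>\<epsilon> * n / 32 \<le> k\<close> below then yields
    \<open>2 * n \<le> k * k\<close>.\<close>
  have n': "2048 \<le> \<epsilon>\<^sup>2 * real n"
    using n \<epsilon> by (simp add: field_simps)
  have "\<epsilon>\<^sup>2 * real n \<le> 2 * (\<epsilon> * real n)"
    using \<epsilon> by (simp add: power2_eq_square mult_right_mono)
  then have en: "1024 \<le> \<epsilon> * real n" using n' by simp
  then have k: "\<epsilon> * real n / 16 - 1 \<le> real k" "real k \<le> \<epsilon> * real n / 16"
    unfolding k_def by linarith+
  have "\<epsilon> * real n \<le> 2 * real n" using \<epsilon> by (simp add: mult_right_mono)
  then have kn: "k + k \<le> n" using k(2) by linarith
  \<comment> \<open>Halving \<open>\<epsilon> * n / 16\<close> absorbs the loss of at most 1 from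
    rounding.\<close>
  have "\<epsilon> * real n / 32 \<le> real k" using k(1) en by linarith
  then have "(\<epsilon> * real n / 32) * (\<epsilon> * real n / 32) \<le> real k * real k"
    using \<epsilon> by (intro mult_mono) auto
  moreover have "2048 * real n \<le> \<epsilon>\<^sup>2 * real n * real n"
    using n' by (intro mult_right_mono) auto
  ultimately have "2 * real n \<le> real (k * k)"
    by (simp add: power2_eq_square field_simps)
  then have kk: "2 * n \<le> k * k" by linarith
  show ?thesis
  proof (rule worst_case_queries_ge[OF A solves kn])
    show "Suc (n div 6) + (n - k - k) \<le> Suc (k * k)" using kk by linarith
    fix X X' b
    assume X: "X \<le> 1 - (3 * real n - 2 * real (k + k)) / (real n + 2)"
      "1 - real n / (real n + 2) \<le> X'"
    \<comment> \<open>\<open>4 * k\<close> is at most a quarter of \<open>\<epsilon> * n\<close>;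
      the rest outweighs the constant that arises from \<open>n + 2\<close>.\<close>
    have "(2 - \<epsilon>) * (real n + 2) < 2 * real n - 4 * real k"
      using k(2) en \<epsilon> by (simp add: algebra_simps)
    then have "2 - \<epsilon> < (2 * real n - 4 * real k) / (real n + 2)"
      by (simp add: pos_less_divide_eq)
    also have "\<dots> = (3 * real n - 2 * real (k + k)) / (real n + 2) - real n / (real n + 2)"
      by (simp flip: diff_divide_distrib)
    also have "\<dots> \<le> X' - X" using X by linarith
    finally show "additive_approx (2 - \<epsilon>) X b \<Longrightarrow> \<not> additive_approx (2 - \<epsilon>) X' b"
      by (auto simp: additive_approx_def)
  qed auto
qed

lemma ennreal_less_if_of_nat_le:
  assumes "0 \<le> x" "x < real c" "of_nat c \<le> y"
  shows "ennreal x < y"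
proof -
  have "ennreal x < ennreal (real c)" using assms(1,2) by (simp add: ennreal_less_iff)
  then show ?thesis using assms(3) by (simp add: ennreal_of_nat_eq_real_of_nat)
qed

text \<open>The thresholds are sharp: the first inequality is an equality at \<open>n = 6\<close>,
  and at \<open>n = 2\<close> the product is 0.\<close>

lemma halves_product_bounds:
  fixes n :: nat
  shows "7 \<le> n \<Longrightarrow> n\<^sup>2 < 6 * (n div 2 * ((n - 1) div 2))"
    and "3 \<le> n \<Longrightarrow> n < 6 * (n div 2 * ((n - 1) div 2))"
proof -
  have "(7 \<le> n \<longrightarrow> n\<^sup>2 < 6 * (n div 2 * ((n - 1) div 2))) \<and>
    (3 \<le> n \<longrightarrow> n < 6 * (n div 2 * ((n - 1) div 2)))"
  proof (cases "n = 0")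
    case False
    define m p where "m = (n - 1) div 2" and "p = m * m"
    \<comment> \<open>These facts replace the square \<open>m * m\<close> by an atom
      \<open>p\<close>, so that linear arithmetic can finish.\<close>
    have p: "m < 3 \<or> 3 * m \<le> p" "m \<le> p"
      unfolding p_def by (metis mult_le_mono1 not_less, simp)
    have "n = 2 * m + 1 \<or> n = 2 * m + 2"
      using False unfolding m_def by presburger
    then show ?thesis
    proof
      assume n: "n = 2 * m + 1"
      have "n\<^sup>2 = 4 * p + 4 * m + 1" "n div 2 * ((n - 1) div 2) = p"
        unfolding n by (simp_all add: p_def power2_eq_square)
      then show ?thesis using n p by linarith
    next
      assume n: "n = 2 * m + 2"
      have "n\<^sup>2 = 4 * p + 8 * m + 4" "n div 2 * ((n - 1) div 2) = p + m"
        unfolding n by (simp_all add: p_def power2_eq_square)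
      then show ?thesis using n p by linarith
    qed
  qed simp
  then show "7 \<le> n \<Longrightarrow> n\<^sup>2 < 6 * (n div 2 * ((n - 1) div 2))"
    "3 \<le> n \<Longrightarrow> n < 6 * (n div 2 * ((n - 1) div 2))" by blast+
qed

theorem theorem2:
  shows "(\<forall>n\<ge>7. \<forall>A. uses_queries node_pair_queries A \<and> solves exact n A \<longrightarrow>
            worst_case_queries n A > ennreal (real n ^ 2 / 6)) \<and>
         (\<forall>n\<ge>3. \<forall>A. uses_queries neighbor_queries A \<and> solves exact n A \<longrightarrow>
            worst_case_queries n A > ennreal (real n / 6)) \<and>
         (\<forall>\<epsilon>::real. 0 < \<epsilon> \<and> \<epsilon> < 2 \<longrightarrow>
            (\<exists>N. \<forall>n\<ge>N. \<forall>A. uses_queries node_pair_queries A \<and>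
               solves (additive_approx (2 - \<epsilon>)) n A \<longrightarrow>
               worst_case_queries n A > ennreal (real n / 6)))"
proof (intro conjI allI impI, goal_cases)
  case (1 n A)
  have "real (n\<^sup>2) < real (6 * (n div 2 * ((n - 1) div 2)))"
    using halves_product_bounds(1)[OF 1(1)] by (simp only: of_nat_less_iff)
  then show ?case
    using 1 by (intro ennreal_less_if_of_nat_le[OF _ _ worst_case_queries_exact]) auto
next
  case (2 n A)
  \<comment> \<open>A neighbor query also reveals at most one pair, so the same quadratic bound is
    available and is merely weakened.\<close>
  have "real n < real (6 * (n div 2 * ((n - 1) div 2)))"
    using halves_product_bounds(2)[OF 2(1)] by (simp only: of_nat_less_iff)
  then show ?case
    using 2 by (intro ennreal_less_if_of_nat_le[OF _ _ worst_case_queries_exact]) auto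
next
  case (3 \<epsilon>)
  show ?case
  proof (intro exI[of _ "nat \<lceil>2048 / \<epsilon>\<^sup>2\<rceil>"] allI impI)
    fix n A
    assume n: "nat \<lceil>2048 / \<epsilon>\<^sup>2\<rceil> \<le> n"
      and A: "uses_queries node_pair_queries A \<and> solves (additive_approx (2 - \<epsilon>)) n A"
    have "2048 / \<epsilon>\<^sup>2 \<le> real n" using n by linarith
    \<comment> \<open>The \<open>Suc\<close> makes the inequality strict in spite of
      rounding.\<close>
    moreover have "real n / 6 < real (Suc (n div 6))" by linarith
    ultimately show "ennreal (real n / 6) < worst_case_queries n A"
      using 3 A by (intro ennreal_less_if_of_nat_le[OF _ _
            worst_case_queries_additive_approx[of node_pair_queries]]) auto
  qed
qed

end
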